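(* Let $\Bbbk$ be a field of characteristic different from $2$ containing a primitive $4$th root of unity $\omega$. The quasitriangular Hopf algebra $(A''_{C_4})^{*}$ (with its quasitriangular structure $\mathcal{R}$ given in the context) admits no non-zero infinitesimal $\mathcal{R}$-matrices; that is, if $\chi$ is an infinitesimal $\mathcal{R}$-matrix for $((A''_{C_4})^{*},\mathcal{R})$, then $\chi=0$.
   Context: $(A''_{C_4})^{*}$ is the $8$-dimensional Hopf algebra generated as an algebra by $g,x$ with relations $g^4=1$, $x^2=0$, $xg=\omega gx$, with basis $\{g^i, xg^i : 0\le i\le 3\}$, comultiplication $\Delta(g)=g\otimes g-2gx\otimes g^3x$, $\Delta(x)=1\otimes x+x\otimes g^2$, counit $\varepsilon(g)=1$, $\varepsilon(x)=0$, and antipode $S(g)=g^3$, $S(x)=-xg^2$. Its (unique) quasitriangular structure is $$\mathcal{R}=\tfrac12\big(1\otimes 1+g^2\otimes 1+1\otimes g^2-g^2\otimes g^2\big)-x\otimes x-x\otimes g^2x+g^2x\otimes x-g^2x\otimes g^2x.$$ For a bialgebra $H$ and $T=\sum_i T^i\otimes T_i\in H\otimes H$ write $T_{12}=T\otimes 1$, $T_{23}=1\otimes T$, $T_{13}=\sum_i T^i\otimes 1\otimes T_i$. A quasitriangular structure on $H$ is an invertible $\mathcal{R}\in H\otimes H$ with $\Delta^{\mathrm{op}}(h)=\mathcal{R}\Delta(h)\mathcal{R}^{-1}$ for all $h$, $(\mathrm{Id}\otimes\Delta)(\mathcal{R})=\mathcal{R}_{13}\mathcal{R}_{12}$, $(\Delta\otimes\mathrm{Id})(\mathcal{R})=\mathcal{R}_{13}\mathcal{R}_{23}$.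 An infinitesimal $\mathcal{R}$-matrix for $(H,\mathcal{R})$ is $\chi\in H\otimes H$ such that $\chi\Delta(h)=\Delta(h)\chi$ for all $h\in H$, $(\mathrm{Id}\otimes\Delta)(\chi)=\chi_{12}+\mathcal{R}_{12}^{-1}\chi_{13}\mathcal{R}_{12}$, and $(\Delta\otimes\mathrm{Id})(\chi)=\chi_{23}+\mathcal{R}_{23}^{-1}\chi_{13}\mathcal{R}_{23}$. *)

theory Defs
  imports "HOL-Analysis.Cartesian_Space"
begin

text \<open>
  A finite-dimensional vector space over \<open>'k\<close> with a chosen basis indexed by the finite type \<open>'b\<close> is
  represented by \<open>'k ^ 'b\<close>, the basis vectors being \<open>axis b 1\<close>. The tensor product of \<open>'k ^ 'b\<close> and
  \<open>'k ^ 'c\<close> is then \<open>'k ^ ('b \<times> 'c)\<close>, and triple tensor products are bracketed to the right.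
  Linear maps are given by their values on the basis.
\<close>

section \<open>Linear maps and tensors in coordinates\<close>

abbreviation bvec :: "'b::finite \<Rightarrow> 'k::field ^ 'b"
  where "bvec b \<equiv> axis b 1"

definition lin :: "('b::finite \<Rightarrow> 'k::field ^ 'c::finite) \<Rightarrow> 'k ^ 'b \<Rightarrow> 'k ^ 'c"
  where "lin f u = (\<Sum>b\<in>UNIV. (u $ b) *s f b)"

definition tensor :: "'k::field ^ 'b::finite \<Rightarrow> 'k ^ 'c::finite \<Rightarrow> 'k ^ ('b \<times> 'c)"  (infixr \<open>\<otimes>\<close> 75)
  where "u \<otimes> v = (\<chi> p. u $ fst p * v $ snd p)"

definition flip :: "'k::field ^ ('b::finite \<times> 'c::finite) \<Rightarrow> 'k ^ ('c \<times> 'b)"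
  where "flip t = (\<chi> p. t $ (snd p, fst p))"

definition reassoc ::
    "'k::field ^ (('a::finite \<times> 'b::finite) \<times> 'c::finite) \<Rightarrow> 'k ^ ('a \<times> 'b \<times> 'c)"
  where "reassoc t = (\<chi> p. t $ ((fst p, fst (snd p)), snd (snd p)))"

section \<open>Algebras, bialgebras and Hopf algebras\<close>

record ('b::finite, 'k::field) alg =
  bmul :: "'b \<Rightarrow> 'b \<Rightarrow> 'k ^ 'b"
  unit :: "'k ^ 'b"

record ('b::finite, 'k::field) hopf = "('b, 'k) alg" +
  bcomul :: "'b \<Rightarrow> 'k ^ ('b \<times> 'b)"
  bcounit :: "'b \<Rightarrow> 'k"
  bantipode :: "'b \<Rightarrow> 'k ^ 'b"

definition mul :: "('b::finite, 'k::field, 'z) alg_scheme \<Rightarrow> 'k ^ 'b \<Rightarrow> 'k ^ 'b \<Rightarrow> 'k ^ 'b"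
  where "mul A u v = lin (\<lambda>a. lin (bmul A a) v) u"

definition npow :: "('b::finite, 'k::field, 'z) alg_scheme \<Rightarrow> 'k ^ 'b \<Rightarrow> nat \<Rightarrow> 'k ^ 'b"
  where "npow A u n = (mul A u ^^ n) (unit A)"

definition is_inverse :: "('b::finite, 'k::field, 'z) alg_scheme \<Rightarrow> 'k ^ 'b \<Rightarrow> 'k ^ 'b \<Rightarrow> bool"
  where "is_inverse A u v \<longleftrightarrow> mul A u v = unit A \<and> mul A v u = unit A"

definition inv_of :: "('b::finite, 'k::field, 'z) alg_scheme \<Rightarrow> 'k ^ 'b \<Rightarrow> 'k ^ 'b"
  where "inv_of A u = (THE v. is_inverse A u v)"

definition tensor_alg ::
    "('b::finite, 'k::field, 'z) alg_scheme \<Rightarrow> ('c::finite, 'k, 'y) alg_scheme \<Rightarrow> ('b \<times> 'c, 'k) alg"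
  where "tensor_alg A B =
    \<lparr>bmul = (\<lambda>p q. bmul A (fst p) (fst q) \<otimes> bmul B (snd p) (snd q)), unit = unit A \<otimes> unit B\<rparr>"

abbreviation alg2 :: "('b::finite, 'k::field, 'z) alg_scheme \<Rightarrow> ('b \<times> 'b, 'k) alg"
  where "alg2 H \<equiv> tensor_alg H H"

abbreviation alg3 :: "('b::finite, 'k::field, 'z) alg_scheme \<Rightarrow> ('b \<times> 'b \<times> 'b, 'k) alg"
  where "alg3 H \<equiv> tensor_alg H (tensor_alg H H)"

abbreviation comul :: "('b::finite, 'k::field, 'z) hopf_scheme \<Rightarrow> 'k ^ 'b \<Rightarrow> 'k ^ ('b \<times> 'b)"
  where "comul H \<equiv> lin (bcomul H)"

definition counit :: "('b::finite, 'k::field, 'z) hopf_scheme \<Rightarrow> 'k ^ 'b \<Rightarrow> 'k"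
  where "counit H u = (\<Sum>b\<in>UNIV. u $ b * bcounit H b)"

definition id_comul :: "('b::finite, 'k::field, 'z) hopf_scheme \<Rightarrow> 'k ^ ('b \<times> 'b) \<Rightarrow> 'k ^ ('b \<times> 'b \<times> 'b)"
  where "id_comul H = lin (\<lambda>p. bvec (fst p) \<otimes> bcomul H (snd p))"

definition comul_id :: "('b::finite, 'k::field, 'z) hopf_scheme \<Rightarrow> 'k ^ ('b \<times> 'b) \<Rightarrow> 'k ^ ('b \<times> 'b \<times> 'b)"
  where "comul_id H = lin (\<lambda>p. reassoc (bcomul H (fst p) \<otimes> bvec (snd p)))"

definition is_algebra :: "('b::finite, 'k::field, 'z) alg_scheme \<Rightarrow> bool"
  where "is_algebra A \<longleftrightarrow>
    (\<forall>u v w. mul A (mul A u v) w = mul A u (mul A v w)) \<and>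
    (\<forall>u. mul A (unit A) u = u \<and> mul A u (unit A) = u)"

definition is_bialgebra :: "('b::finite, 'k::field, 'z) hopf_scheme \<Rightarrow> bool"
  where "is_bialgebra H \<longleftrightarrow> is_algebra H \<and>
    (\<forall>u. id_comul H (comul H u) = comul_id H (comul H u)) \<and>
    (\<forall>u. lin (\<lambda>p. bcounit H (fst p) *s bvec (snd p)) (comul H u) = u) \<and>
    (\<forall>u. lin (\<lambda>p. bcounit H (snd p) *s bvec (fst p)) (comul H u) = u) \<and>
    (\<forall>u v. comul H (mul H u v) = mul (alg2 H) (comul H u) (comul H v)) \<and>
    comul H (unit H) = unit (alg2 H) \<and>
    (\<forall>u v. counit H (mul H u v) = counit H u * counit H v) \<and>
    counit H (unit H) = 1"

definition is_hopf_algebra :: "('b::finite, 'k::field, 'z) hopf_scheme \<Rightarrow> bool"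
  where "is_hopf_algebra H \<longleftrightarrow> is_bialgebra H \<and>
    (\<forall>u. lin (\<lambda>p. mul H (bantipode H (fst p)) (bvec (snd p))) (comul H u) = counit H u *s unit H) \<and>
    (\<forall>u. lin (\<lambda>p. mul H (bvec (fst p)) (bantipode H (snd p))) (comul H u) = counit H u *s unit H)"

section \<open>Quasitriangular structures and infinitesimal R-matrices\<close>

definition leg12 :: "('b::finite, 'k::field, 'z) alg_scheme \<Rightarrow> 'k ^ ('b \<times> 'b) \<Rightarrow> 'k ^ ('b \<times> 'b \<times> 'b)"
  where "leg12 H t = reassoc (t \<otimes> unit H)"

definition leg23 :: "('b::finite, 'k::field, 'z) alg_scheme \<Rightarrow> 'k ^ ('b \<times> 'b) \<Rightarrow> 'k ^ ('b \<times> 'b \<times> 'b)"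
  where "leg23 H t = unit H \<otimes> t"

definition leg13 :: "('b::finite, 'k::field, 'z) alg_scheme \<Rightarrow> 'k ^ ('b \<times> 'b) \<Rightarrow> 'k ^ ('b \<times> 'b \<times> 'b)"
  where "leg13 H = lin (\<lambda>p. bvec (fst p) \<otimes> unit H \<otimes> bvec (snd p))"

definition quasitriangular :: "('b::finite, 'k::field, 'z) hopf_scheme \<Rightarrow> 'k ^ ('b \<times> 'b) \<Rightarrow> bool"
  where "quasitriangular H R \<longleftrightarrow>
    (\<exists>S. is_inverse (alg2 H) R S) \<and>
    (\<forall>h. flip (comul H h) = mul (alg2 H) (mul (alg2 H) R (comul H h)) (inv_of (alg2 H) R)) \<and>
    id_comul H R = mul (alg3 H) (leg13 H R) (leg12 H R) \<and>
    comul_id H R = mul (alg3 H) (leg13 H R) (leg23 H R)"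

text \<open>
  \<open>(R\<^sub>1\<^sub>2)\<close> inverse is written as \<open>leg12\<close> of the inverse of \<open>R\<close>, and likewise for \<open>leg23\<close>; the two
  readings agree because \<open>leg12\<close> and \<open>leg23\<close> are unital algebra maps.
\<close>

definition infinitesimal_R_matrix ::
    "('b::finite, 'k::field, 'z) hopf_scheme \<Rightarrow> 'k ^ ('b \<times> 'b) \<Rightarrow> 'k ^ ('b \<times> 'b) \<Rightarrow> bool"
  where "infinitesimal_R_matrix H R c \<longleftrightarrow>
    (\<forall>h. mul (alg2 H) c (comul H h) = mul (alg2 H) (comul H h) c) \<and>
    id_comul H c = leg12 H c +
      mul (alg3 H) (mul (alg3 H) (leg12 H (inv_of (alg2 H) R)) (leg13 H c)) (leg12 H R) \<and>
    comul_id H c = leg23 H c +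
      mul (alg3 H) (mul (alg3 H) (leg23 H (inv_of (alg2 H) R)) (leg13 H c)) (leg23 H R)"

section \<open>The 8-dimensional Hopf algebra\<close>

definition primitive_root_of_unity :: "nat \<Rightarrow> 'k::field \<Rightarrow> bool"
  where "primitive_root_of_unity n w \<longleftrightarrow> 0 < n \<and> w ^ n = 1 \<and> (\<forall>m. 0 < m \<and> m < n \<longrightarrow> w ^ m \<noteq> 1)"

text \<open>
  \<open>A4_dual \<omega>\<close> below is the dual of the pointed Hopf algebra \<open>A''\<close> over the cyclic group of order 4.
  \<open>G i\<close> and \<open>XG i\<close> index the basis elements \<open>g^i\<close> and \<open>x g^i\<close>. Exponents of \<open>g\<close> live in the type \<open>4\<close> of
  integers modulo 4, whose representatives \<open>Rep_bit0 i\<close> are 0, 1, 2, 3.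
\<close>

datatype mon = G 4 | XG 4

lemma UNIV_mon: "(UNIV :: mon set) = G ` UNIV \<union> XG ` UNIV"
  by (auto simp: image_iff) (metis mon.exhaust)

instance mon :: finite
  by standard (simp add: UNIV_mon)

text \<open>The multiplication table below is forced by \<open>g^i x = \<omega>^(-i) x g^i\<close>, \<open>g^4 = 1\<close> and \<open>x^2 = 0\<close>.\<close>

fun A4_bmul :: "'k::field \<Rightarrow> mon \<Rightarrow> mon \<Rightarrow> 'k ^ mon" where
  "A4_bmul \<omega> (G i) (G j) = bvec (G (i + j))"
| "A4_bmul \<omega> (XG i) (G j) = bvec (XG (i + j))"
| "A4_bmul \<omega> (G i) (XG j) = (\<omega> powi (- Rep_bit0 i)) *s bvec (XG (i + j))"
| "A4_bmul \<omega> (XG i) (XG j) = 0"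

definition A4_alg :: "'k::field \<Rightarrow> (mon, 'k) alg"
  where "A4_alg \<omega> = \<lparr>bmul = A4_bmul \<omega>, unit = bvec (G 0)\<rparr>"

definition A4_g :: "'k::field ^ mon" where "A4_g = bvec (G 1)"

definition A4_x :: "'k::field ^ mon" where "A4_x = bvec (XG 0)"

definition A4_comul_g :: "'k::field \<Rightarrow> 'k ^ (mon \<times> mon)"
  where "A4_comul_g \<omega> = A4_g \<otimes> A4_g
    - 2 *s (mul (A4_alg \<omega>) A4_g A4_x \<otimes> mul (A4_alg \<omega>) (npow (A4_alg \<omega>) A4_g 3) A4_x)"

definition A4_comul_x :: "'k::field \<Rightarrow> 'k ^ (mon \<times> mon)"
  where "A4_comul_x \<omega> = unit (A4_alg \<omega>) \<otimes> A4_x + A4_x \<otimes> npow (A4_alg \<omega>) A4_g 2"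

text \<open>
  The comultiplication and the counit are extended from \<open>g\<close>, \<open>x\<close> multiplicatively, the antipode
  antimultiplicatively: \<open>S (x g^i) = S(g)^i S(x)\<close>.
\<close>

fun A4_bcomul :: "'k::field \<Rightarrow> mon \<Rightarrow> 'k ^ (mon \<times> mon)" where
  "A4_bcomul \<omega> (G i) = npow (alg2 (A4_alg \<omega>)) (A4_comul_g \<omega>) (nat (Rep_bit0 i))"
| "A4_bcomul \<omega> (XG i) = mul (alg2 (A4_alg \<omega>)) (A4_comul_x \<omega>)
     (npow (alg2 (A4_alg \<omega>)) (A4_comul_g \<omega>) (nat (Rep_bit0 i)))"

fun A4_bcounit :: "mon \<Rightarrow> 'k::field" where
  "A4_bcounit (G i) = 1"
| "A4_bcounit (XG i) = 0"

fun A4_bantipode :: "'k::field \<Rightarrow> mon \<Rightarrow> 'k ^ mon" where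
  "A4_bantipode \<omega> (G i) = npow (A4_alg \<omega>) (npow (A4_alg \<omega>) A4_g 3) (nat (Rep_bit0 i))"
| "A4_bantipode \<omega> (XG i) =
     mul (A4_alg \<omega>) (npow (A4_alg \<omega>) (npow (A4_alg \<omega>) A4_g 3) (nat (Rep_bit0 i)))
       (- mul (A4_alg \<omega>) A4_x (npow (A4_alg \<omega>) A4_g 2))"

definition A4_dual :: "'k::field \<Rightarrow> (mon, 'k) hopf"
  where "A4_dual \<omega> = \<lparr>bmul = A4_bmul \<omega>, unit = bvec (G 0),
    bcomul = A4_bcomul \<omega>, bcounit = A4_bcounit, bantipode = A4_bantipode \<omega>\<rparr>"

definition A4_R :: "'k::field \<Rightarrow> 'k ^ (mon \<times> mon)"
  where "A4_R \<omega> = (let e = unit (A4_dual \<omega>); x = A4_x; g2 = npow (A4_dual \<omega>) A4_g 2;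
      g2x = mul (A4_dual \<omega>) g2 x in
    (1 / 2) *s (e \<otimes> e + g2 \<otimes> e + e \<otimes> g2 - g2 \<otimes> g2)
      - x \<otimes> x - x \<otimes> g2x + g2x \<otimes> x - g2x \<otimes> g2x)"

section \<open>The data above form a quasitriangular Hopf algebra\<close>

text \<open>
  These facts confirm that \<open>A4_alg \<omega>\<close> satisfies the defining relations with the stated basis
  (\<open>A4_relations\<close>, \<open>A4_basis\<close>), that \<open>A4_dual \<omega>\<close> is a Hopf algebra (\<open>A4_dual_hopf_algebra\<close>), and
  that \<open>A4_R \<omega>\<close> is a quasitriangular structure on it (\<open>A4_R_quasitriangular\<close>).
\<close>

lemma lin_bvec [simp]: "lin f (bvec b) = f b"
  by (simp add: lin_def axis_def if_distrib[of "\<lambda>c. c *s _"] cong: if_cong)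

lemma lin_add: "lin f (u + v) = lin f u + lin f v"
  by (simp add: lin_def vec.scale_left_distrib sum.distrib)

lemma lin_scale: "lin f (c *s u) = c *s lin f u"
  by (simp add: lin_def vec.scale_sum_right)

lemma lin_minus: "lin f (- u) = - lin f u"
  by (simp add: lin_def sum_negf)

lemma lin_diff: "lin f (u - v) = lin f u - lin f v"
  by (simp add: lin_def vec.scale_left_diff_distrib sum_subtractf)

lemma lin_zero: "lin f 0 = 0"
  by (simp add: lin_def)

lemmas lin_simps = lin_add lin_scale lin_minus lin_diff lin_zero

lemma lin_linear: "Vector_Spaces.linear (*s) (*s) (lin f)"
  by unfold_locales (simp_all add: lin_simps vec.scale_right_distrib vec.scale_left_distrib)

lemma lin_pointwise:
  "lin (\<lambda>a. f a + h a) u = lin f u + lin h u"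
  "lin (\<lambda>a. c *s f a) u = c *s lin f u"
  "lin (\<lambda>a. - f a) u = - lin f u"
  "lin (\<lambda>a. f a - h a) u = lin f u - lin h u"
  "lin (\<lambda>a. 0) u = 0"
  by (simp_all add: lin_def vec.scale_right_distrib vec.scale_right_diff_distrib sum.distrib
      sum_subtractf sum_negf vec.scale_sum_right mult.commute)

lemma mul_simps:
  "mul A (u + u') v = mul A u v + mul A u' v"
  "mul A (u - u') v = mul A u v - mul A u' v"
  "mul A (- u) v = - mul A u v"
  "mul A (c *s u) v = c *s mul A u v"
  "mul A 0 v = 0"
  "mul A v (u + u') = mul A v u + mul A v u'"
  "mul A v (u - u') = mul A v u - mul A v u'"
  "mul A v (- u) = - mul A v u"
  "mul A v (c *s u) = c *s mul A v u"
  "mul A v 0 = 0"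
  by (simp_all add: mul_def lin_simps lin_pointwise)

lemma mul_bvec: "mul A (bvec a) (bvec b) = bmul A a b"
  by (simp add: mul_def)

lemma tensor_nth: "(u \<otimes> v) $ (a, b) = u $ a * v $ b"
  by (simp add: tensor_def)

lemma tensor_simps:
  "(u + u') \<otimes> v = u \<otimes> v + u' \<otimes> v"
  "(u - u') \<otimes> v = u \<otimes> v - u' \<otimes> v"
  "(- u) \<otimes> v = - (u \<otimes> v)"
  "(c *s u) \<otimes> v = c *s (u \<otimes> v)"
  "0 \<otimes> v = 0"
  "v \<otimes> (u + u') = v \<otimes> u + v \<otimes> u'"
  "v \<otimes> (u - u') = v \<otimes> u - v \<otimes> u'"
  "v \<otimes> (- u) = - (v \<otimes> u)"
  "v \<otimes> (c *s u) = c *s (v \<otimes> u)"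
  "v \<otimes> 0 = 0"
  by (simp_all add: tensor_def vec_eq_iff algebra_simps)

lemma bvec_tensor: "bvec (a, b) = bvec a \<otimes> bvec b"
  by (auto simp: tensor_def axis_def vec_eq_iff)

lemma bvec_tensor': "bvec p = bvec (fst p) \<otimes> bvec (snd p)"
  by (cases p) (simp add: bvec_tensor)

lemma vec_expand: "(u :: 'k::field ^ 'b::finite) = (\<Sum>a\<in>UNIV. (u $ a) *s bvec a)"
  using basis_expansion[of u] by simp

lemma linear_ext:
  assumes "Vector_Spaces.linear (*s) (*s) f" "Vector_Spaces.linear (*s) (*s) h"
    and "\<And>b. f (bvec b) = h (bvec b)"
  shows "f u = h (u :: 'k::field ^ 'b::finite)"
proof -
  interpret f: Vector_Spaces.linear "(*s)" "(*s)" f by fact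
  interpret h: Vector_Spaces.linear "(*s)" "(*s)" h by fact
  show ?thesis
    by (subst (1 2) vec_expand) (simp add: f.sum h.sum f.scale h.scale assms(3))
qed

lemma linear_axioms:
  assumes "\<And>u v. f (u + v) = f u + f v" "\<And>c u. f (c *s u) = c *s f u"
  shows "Vector_Spaces.linear (*s) (*s) (f :: 'k::field ^ 'b::finite \<Rightarrow> 'k ^ 'c::finite)"
  by unfold_locales (simp_all add: assms vec.scale_right_distrib vec.scale_left_distrib)

lemma mul_tensor:
  "mul (tensor_alg A B) (u \<otimes> v) (u' \<otimes> v') = mul A u u' \<otimes> mul B v v'"
proof -
  have 1: "mul (tensor_alg A B) (bvec a \<otimes> bvec b) (bvec a' \<otimes> bvec b') = mul A (bvec a) (bvec a') \<otimes> mul B (bvec b) (bvec b')" for a b a' b'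
    by (simp add: mul_bvec tensor_alg_def flip: bvec_tensor)
  have 2: "mul (tensor_alg A B) (bvec a \<otimes> bvec b) (bvec a' \<otimes> v') = mul A (bvec a) (bvec a') \<otimes> mul B (bvec b) v'" for a b a'
    by (rule linear_ext[where u = v']) (auto intro!: linear_axioms simp: mul_simps tensor_simps 1)
  have 3: "mul (tensor_alg A B) (bvec a \<otimes> bvec b) (u' \<otimes> v') = mul A (bvec a) u' \<otimes> mul B (bvec b) v'" for a b
    by (rule linear_ext[where u = u']) (auto intro!: linear_axioms simp: mul_simps tensor_simps 2)
  have 4: "mul (tensor_alg A B) (bvec a \<otimes> v) (u' \<otimes> v') = mul A (bvec a) u' \<otimes> mul B v v'" for a
    by (rule linear_ext[where u = v]) (auto intro!: linear_axioms simp: mul_simps tensor_simps 3)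
  show ?thesis
    by (rule linear_ext[where u = u]) (auto intro!: linear_axioms simp: mul_simps tensor_simps 4)
qed

lemma lin_tensor: "lin f (bvec a \<otimes> bvec b) = f (a, b)"
  by (simp flip: bvec_tensor)

lemma unit_tensor: "unit (tensor_alg A B) = unit A \<otimes> unit B"
  by (simp add: tensor_alg_def)

lemma reassoc_simps:
  "reassoc (s + t) = reassoc s + reassoc t"
  "reassoc (s - t) = reassoc s - reassoc t"
  "reassoc (- t) = - reassoc t"
  "reassoc (c *s t) = c *s reassoc t"
  "reassoc 0 = 0"
  "reassoc ((u \<otimes> v) \<otimes> w) = u \<otimes> v \<otimes> w"
  by (simp_all add: reassoc_def tensor_def vec_eq_iff mult.assoc)

lemma flip_simps:
  "flip (s + t) = flip s + flip t"
  "flip (s - t) = flip s - flip t"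
  "flip (- t) = - flip t"
  "flip (c *s t) = c *s flip t"
  "flip 0 = 0"
  "flip (u \<otimes> v) = v \<otimes> u"
  by (simp_all add: flip_def tensor_def vec_eq_iff mult.commute)

lemma leg13_simps:
  "leg13 H (s + t) = leg13 H s + leg13 H t"
  "leg13 H (s - t) = leg13 H s - leg13 H t"
  "leg13 H (- t) = - leg13 H t"
  "leg13 H (c *s t) = c *s leg13 H t"
  "leg13 H 0 = 0"
  "leg13 H (bvec a \<otimes> bvec b) = bvec a \<otimes> unit H \<otimes> bvec b"
  by (simp_all add: leg13_def lin_simps lin_tensor)

lemma comulid_simps:
  "id_comul H (s + t) = id_comul H s + id_comul H t"
  "id_comul H (s - t) = id_comul H s - id_comul H t"
  "id_comul H (- t) = - id_comul H t"
  "id_comul H (c *s t) = c *s id_comul H t"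
  "id_comul H 0 = 0"
  "id_comul H (bvec a \<otimes> bvec b) = bvec a \<otimes> bcomul H b"
  "comul_id H (s + t) = comul_id H s + comul_id H t"
  "comul_id H (s - t) = comul_id H s - comul_id H t"
  "comul_id H (- t) = - comul_id H t"
  "comul_id H (c *s t) = c *s comul_id H t"
  "comul_id H 0 = 0"
  "comul_id H (bvec a \<otimes> bvec b) = reassoc (bcomul H a \<otimes> bvec b)"
  by (simp_all add: id_comul_def comul_id_def lin_simps lin_tensor)

lemma counit_lin: "counit H (u + v) = counit H u + counit H v"  "counit H (c *s u) = c * counit H u" "counit H (bvec b) = bcounit H b"
  "counit H (u - v) = counit H u - counit H v" "counit H (- v) = - counit H v" "counit H 0 = 0"
  by (simp_all add: counit_def distrib_right left_diff_distrib mult.assoc sum.distrib sum_subtractf sum_distrib_left sum_negf axis_def if_distrib[of "\<lambda>c. c * _"] if_distrib[of "\<lambda>c. _ * c"] of_bool_def cong: if_cong)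

lemma two_vec: "2 * v = 2 *s (v :: 'k::field ^ 'n::finite)"
  by (simp add: vec_eq_iff)

lemma four_vec: "4 * v = 4 *s (v :: 'k::field ^ 'n::finite)"
  by (simp add: vec_eq_iff)

lemma tensor_alg_algebra:
  assumes "is_algebra A" "is_algebra B"
  shows "is_algebra (tensor_alg A B)"
proof -
  have assoc: "mul (tensor_alg A B) (mul (tensor_alg A B) u v) w = mul (tensor_alg A B) u (mul (tensor_alg A B) v w)" for u v w
  proof -
    have 1: "mul (tensor_alg A B) (mul (tensor_alg A B) (bvec p) (bvec q)) (bvec r) = mul (tensor_alg A B) (bvec p) (mul (tensor_alg A B) (bvec q) (bvec r))" for p q r
      using assms by (simp add: bvec_tensor'[of p] bvec_tensor'[of q] bvec_tensor'[of r] mul_tensor is_algebra_def)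
    have 2: "mul (tensor_alg A B) (mul (tensor_alg A B) (bvec p) (bvec q)) w = mul (tensor_alg A B) (bvec p) (mul (tensor_alg A B) (bvec q) w)" for p q
      by (rule linear_ext[where u = w]) (auto intro!: linear_axioms simp: mul_simps 1)
    have 3: "mul (tensor_alg A B) (mul (tensor_alg A B) (bvec p) v) w = mul (tensor_alg A B) (bvec p) (mul (tensor_alg A B) v w)" for p
      by (rule linear_ext[where u = v]) (auto intro!: linear_axioms simp: mul_simps 2)
    show ?thesis
      by (rule linear_ext[where u = u]) (auto intro!: linear_axioms simp: mul_simps 3)
  qed
  have 1: "mul (tensor_alg A B) (unit (tensor_alg A B)) (bvec p) = bvec p" "mul (tensor_alg A B) (bvec p) (unit (tensor_alg A B)) = bvec p" for p
    using assms by (simp_all add: bvec_tensor'[of p] unit_tensor mul_tensor is_algebra_def)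
  have 2: "mul (tensor_alg A B) (unit (tensor_alg A B)) u = u" "mul (tensor_alg A B) u (unit (tensor_alg A B)) = u" for u
    by (rule linear_ext[where u = u]; auto intro!: linear_axioms simp: mul_simps 1)+
  show ?thesis by (simp add: is_algebra_def assoc 2)
qed

lemma all4: "(\<forall>i::4. P i) \<longleftrightarrow> P 0 \<and> P 1 \<and> P 2 \<and> P 3"
proof -
  have "(4::4) = 0" by simp
  then show ?thesis by (metis forall_4)
qed

lemma num4: "(4::4) = 0" "(5::4) = 1" "(6::4) = 2" "(7::4) = 3" "(8::4) = 0" "(9::4) = 1"
  by simp_all

lemma all_mon: "(\<forall>m. P m) \<longleftrightarrow> (\<forall>i. P (G i)) \<and> (\<forall>i. P (XG i))"
  by (metis mon.exhaust)

lemma Rep4: "Rep_bit0 (0::4) = 0" "Rep_bit0 (1::4) = 1" "Rep_bit0 (2::4) = 2" "Rep_bit0 (3::4) = 3"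
  by (simp_all add: bit0.Rep_0 bit0.Rep_1 bit0.Rep_numeral)

lemma primitive4:
  assumes "primitive_root_of_unity 4 \<omega>"
  shows "\<omega> * \<omega> = - 1"
proof -
  have "\<omega> ^ 4 = 1" "\<omega> ^ 2 \<noteq> 1" using assms by (auto simp: primitive_root_of_unity_def)
  moreover have "\<omega> ^ 4 - 1 = (\<omega>^2 - 1) * (\<omega>^2 + 1)" by (simp add: algebra_simps eval_nat_numeral)
  ultimately show ?thesis by (simp add: power2_eq_square eq_neg_iff_add_eq_0)
qed

lemma powi4:
  assumes "\<omega> * \<omega> = (- 1 :: 'k::field)"
  shows "\<omega> powi (-1) = - \<omega>" "\<omega> powi (-2) = - 1" "\<omega> powi (-3) = \<omega>" "inverse \<omega> = - \<omega>"
proof -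
  have "\<omega> \<noteq> 0" using assms by auto
  have i: "inverse \<omega> = - \<omega>" by (rule inverse_unique) (simp add: assms)
  show "\<omega> powi (-1) = - \<omega>" "\<omega> powi (-2) = - 1" "\<omega> powi (-3) = \<omega>" "inverse \<omega> = - \<omega>"
    by (simp_all add: power_int_def i eval_nat_numeral assms flip: mult.assoc)
qed

lemma two_nonzero:
  assumes "CHAR('k::field) \<noteq> 2" shows "(2::'k) \<noteq> 0"
proof
  assume "(2::'k) = 0"
  then have "of_nat 2 = (0::'k)" by simp
  then have "CHAR('k) dvd 2" by (simp only: of_nat_eq_0_iff_char_dvd)
  then have "CHAR('k) = 1 \<or> CHAR('k) = 2"
    using dvd_imp_le[of "CHAR('k)" 2] by (cases "CHAR('k) = 0") (auto simp: le_less less_Suc_eq numeral_2_eq_2)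
  then show False using assms by (auto simp: CHAR_not_1)
qed

lemma alg_sel [simp]:
  "unit (A4_alg \<omega>) = bvec (G 0)" "bmul (A4_alg \<omega>) = A4_bmul \<omega>"
  "unit (A4_dual \<omega>) = bvec (G 0)" "bmul (A4_dual \<omega>) = A4_bmul \<omega>"
  "bcomul (A4_dual \<omega>) = A4_bcomul \<omega>" "bcounit (A4_dual \<omega>) = A4_bcounit"
  "bantipode (A4_dual \<omega>) = A4_bantipode \<omega>"
  by (simp_all add: A4_alg_def A4_dual_def)

lemma mul_eq [simp]: "mul (A4_dual \<omega>) = mul (A4_alg \<omega>)"
  by (simp add: mul_def fun_eq_iff)

lemma tensor_alg_eq [simp]:
  "tensor_alg (A4_dual \<omega>) B = tensor_alg (A4_alg \<omega>) B"
  "tensor_alg B (A4_dual \<omega>) = tensor_alg B (A4_alg \<omega>)"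
  by (simp_all add: tensor_alg_def)

lemma npow_eq [simp]: "npow (A4_dual \<omega>) = npow (A4_alg \<omega>)"
  by (simp add: npow_def fun_eq_iff)

lemma npow_0: "npow A u 0 = unit A" and npow_Suc: "npow A u (Suc n) = mul A u (npow A u n)"
  by (simp_all add: npow_def)

definition A4_R_inv :: "'k::field ^ (mon \<times> mon)" where
  "A4_R_inv = (1/2) *s (bvec (G 0) \<otimes> bvec (G 0) + bvec (G 2) \<otimes> bvec (G 0) + bvec (G 0) \<otimes> bvec (G 2) - bvec (G 2) \<otimes> bvec (G 2))
   - bvec (XG 0) \<otimes> bvec (XG 0) - bvec (XG 0) \<otimes> bvec (XG 2) + bvec (XG 2) \<otimes> bvec (XG 0) - bvec (XG 2) \<otimes> bvec (XG 2)"

context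
  fixes \<omega> :: "'k::field"
  assumes w: "\<omega> * \<omega> = - 1"
begin

lemma ww: "\<omega> * (\<omega> * c) = - c"
  using w by (metis mult.assoc mult_minus1)

lemmas calc = mul_simps mul_bvec tensor_simps mul_tensor Rep4 num4 powi4[OF w] unit_tensor w ww

lemma A4_algebra: "is_algebra (A4_alg \<omega>)"
proof -
  have "\<forall>a b c. mul (A4_alg \<omega>) (mul (A4_alg \<omega>) (bvec a) (bvec b)) (bvec c) =
     mul (A4_alg \<omega>) (bvec a) (mul (A4_alg \<omega>) (bvec b) (bvec c))"
    by (simp add: all_mon all4 calc)
  then have 1: "mul (A4_alg \<omega>) (mul (A4_alg \<omega>) (bvec a) (bvec b)) (bvec c) =
     mul (A4_alg \<omega>) (bvec a) (mul (A4_alg \<omega>) (bvec b) (bvec c))" for a b c by blast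
  have 2: "mul (A4_alg \<omega>) (mul (A4_alg \<omega>) (bvec a) (bvec b)) w =
     mul (A4_alg \<omega>) (bvec a) (mul (A4_alg \<omega>) (bvec b) w)" for a b w
    by (rule linear_ext[where u = w]) (auto intro!: linear_axioms simp: mul_simps 1)
  have 3: "mul (A4_alg \<omega>) (mul (A4_alg \<omega>) (bvec a) v) w =
     mul (A4_alg \<omega>) (bvec a) (mul (A4_alg \<omega>) v w)" for a v w
    by (rule linear_ext[where u = v]) (auto intro!: linear_axioms simp: mul_simps 2)
  have 4: "mul (A4_alg \<omega>) (mul (A4_alg \<omega>) u v) w =
     mul (A4_alg \<omega>) u (mul (A4_alg \<omega>) v w)" for u v w
    by (rule linear_ext[where u = u]) (auto intro!: linear_axioms simp: mul_simps 3)
  have "\<forall>a. mul (A4_alg \<omega>) (unit (A4_alg \<omega>)) (bvec a) = bvec a \<and> mul (A4_alg \<omega>) (bvec a) (unit (A4_alg \<omega>)) = bvec a"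
    by (simp add: all_mon all4 calc)
  then have 5: "mul (A4_alg \<omega>) (unit (A4_alg \<omega>)) (bvec a) = bvec a"
    "mul (A4_alg \<omega>) (bvec a) (unit (A4_alg \<omega>)) = bvec a" for a by blast+
  have 6: "mul (A4_alg \<omega>) (unit (A4_alg \<omega>)) u = u" for u
    by (rule linear_ext[where u = u]) (auto intro!: linear_axioms simp: mul_simps 5 simp del: alg_sel)
  have 7: "mul (A4_alg \<omega>) u (unit (A4_alg \<omega>)) = u" for u
    by (rule linear_ext[where u = u]) (auto intro!: linear_axioms simp: mul_simps 5 simp del: alg_sel)
  show ?thesis by (simp add: is_algebra_def 4 6 7 del: alg_sel)
qed

lemma A4_relations:
  "npow (A4_alg \<omega>) A4_g 4 = unit (A4_alg \<omega>)"
  "mul (A4_alg \<omega>) A4_x A4_x = 0"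
  "mul (A4_alg \<omega>) A4_x A4_g = \<omega> *s mul (A4_alg \<omega>) A4_g A4_x"
  by (simp_all add: A4_g_def A4_x_def eval_nat_numeral npow_0 npow_Suc calc)

lemma A4_basis:
  "bvec (G i) = npow (A4_alg \<omega>) A4_g (nat (Rep_bit0 i))"
  "bvec (XG i) = mul (A4_alg \<omega>) A4_x (npow (A4_alg \<omega>) A4_g (nat (Rep_bit0 i)))"
proof -
  have "\<forall>i. bvec (G i) = npow (A4_alg \<omega>) A4_g (nat (Rep_bit0 i)) \<and>
    bvec (XG i) = mul (A4_alg \<omega>) A4_x (npow (A4_alg \<omega>) A4_g (nat (Rep_bit0 i)))"
    by (simp add: all4 A4_g_def A4_x_def eval_nat_numeral npow_0 npow_Suc calc)
  then show "bvec (G i) = npow (A4_alg \<omega>) A4_g (nat (Rep_bit0 i))"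
    "bvec (XG i) = mul (A4_alg \<omega>) A4_x (npow (A4_alg \<omega>) A4_g (nat (Rep_bit0 i)))" by auto
qed

lemma comul_table:
  "A4_bcomul \<omega> (G 0) = bvec (G 0) \<otimes> bvec (G 0)"
  "A4_bcomul \<omega> (G 1) = bvec (G 1) \<otimes> bvec (G 1) - 2 *s (bvec (XG 1) \<otimes> bvec (XG 3))"
  "A4_bcomul \<omega> (G 2) = bvec (G 2) \<otimes> bvec (G 2)"
  "A4_bcomul \<omega> (G 3) = bvec (G 3) \<otimes> bvec (G 3) - 2 *s (bvec (XG 3) \<otimes> bvec (XG 1))"
  "A4_bcomul \<omega> (XG 0) = bvec (G 0) \<otimes> bvec (XG 0) + bvec (XG 0) \<otimes> bvec (G 2)"
  "A4_bcomul \<omega> (XG 1) = bvec (G 1) \<otimes> bvec (XG 1) + bvec (XG 1) \<otimes> bvec (G 3)"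
  "A4_bcomul \<omega> (XG 2) = bvec (G 2) \<otimes> bvec (XG 2) + bvec (XG 2) \<otimes> bvec (G 0)"
  "A4_bcomul \<omega> (XG 3) = bvec (G 3) \<otimes> bvec (XG 3) + bvec (XG 3) \<otimes> bvec (G 1)"
  by (simp_all add: A4_comul_g_def A4_comul_x_def A4_g_def A4_x_def eval_nat_numeral npow_0 npow_Suc calc)

lemma comul_mul: "comul (A4_dual \<omega>) (mul (A4_alg \<omega>) u v)
    = mul (alg2 (A4_alg \<omega>)) (comul (A4_dual \<omega>) u) (comul (A4_dual \<omega>) v)"
proof -
  have "\<forall>a b. comul (A4_dual \<omega>) (mul (A4_alg \<omega>) (bvec a) (bvec b))
    = mul (alg2 (A4_alg \<omega>)) (comul (A4_dual \<omega>) (bvec a)) (comul (A4_dual \<omega>) (bvec b))"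
    apply (simp add: all_mon all4 calc lin_simps comul_table del: A4_bcomul.simps)
    apply (simp add: vec_eq_iff tensor_nth)
    apply (simp add: algebra_simps)
    done
  then have 1: "comul (A4_dual \<omega>) (mul (A4_alg \<omega>) (bvec a) (bvec b))
    = mul (alg2 (A4_alg \<omega>)) (comul (A4_dual \<omega>) (bvec a)) (comul (A4_dual \<omega>) (bvec b))" for a b by blast
  have 2: "comul (A4_dual \<omega>) (mul (A4_alg \<omega>) (bvec a) v)
    = mul (alg2 (A4_alg \<omega>)) (comul (A4_dual \<omega>) (bvec a)) (comul (A4_dual \<omega>) v)" for a
    by (rule linear_ext[where u = v]) (auto intro!: linear_axioms simp: mul_simps lin_simps 1 simp del: alg_sel lin_bvec)
  show ?thesis
    by (rule linear_ext[where u = u]) (auto intro!: linear_axioms simp: mul_simps lin_simps 2 simp del: alg_sel lin_bvec)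
qed

lemma comul_unit: "comul (A4_dual \<omega>) (unit (A4_dual \<omega>)) = unit (alg2 (A4_dual \<omega>))"
  by (simp add: calc comul_table del: A4_bcomul.simps)

lemma coassoc: "id_comul (A4_dual \<omega>) (comul (A4_dual \<omega>) u) = comul_id (A4_dual \<omega>) (comul (A4_dual \<omega>) u)"
proof (rule linear_ext[where u = u])
  have "\<forall>b. id_comul (A4_dual \<omega>) (comul (A4_dual \<omega>) (bvec b)) = comul_id (A4_dual \<omega>) (comul (A4_dual \<omega>) (bvec b))"
    apply (simp add: all_mon all4 calc comulid_simps reassoc_simps comul_table del: A4_bcomul.simps)
    by (simp add: vec_eq_iff algebra_simps)
  then show "\<And>b. id_comul (A4_dual \<omega>) (comul (A4_dual \<omega>) (bvec b)) = comul_id (A4_dual \<omega>) (comul (A4_dual \<omega>) (bvec b))" by blast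
qed (auto intro!: linear_axioms simp: comulid_simps lin_simps)

lemma counits:
  "lin (\<lambda>p. bcounit (A4_dual \<omega>) (fst p) *s bvec (snd p)) (comul (A4_dual \<omega>) u) = u" (is "?A u = _")
  "lin (\<lambda>p. bcounit (A4_dual \<omega>) (snd p) *s bvec (fst p)) (comul (A4_dual \<omega>) u) = u" (is "?B u = _")
  "lin (\<lambda>p. mul (A4_dual \<omega>) (bantipode (A4_dual \<omega>) (fst p)) (bvec (snd p))) (comul (A4_dual \<omega>) u) = counit (A4_dual \<omega>) u *s unit (A4_dual \<omega>)" (is "?C u = ?E u")
  "lin (\<lambda>p. mul (A4_dual \<omega>) (bvec (fst p)) (bantipode (A4_dual \<omega>) (snd p))) (comul (A4_dual \<omega>) u) = counit (A4_dual \<omega>) u *s unit (A4_dual \<omega>)" (is "?D u = _")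
proof -
  have "\<forall>b. ?A (bvec b) = bvec b" "\<forall>b. ?B (bvec b) = bvec b" "\<forall>b. ?C (bvec b) = ?E (bvec b)" "\<forall>b. ?D (bvec b) = ?E (bvec b)"
    by (simp_all add: all_mon all4 A4_g_def A4_x_def calc comul_table lin_simps lin_tensor counit_lin eval_nat_numeral npow_0 npow_Suc del: A4_bcomul.simps)
  then have *: "?A (bvec b) = bvec b" "?B (bvec b) = bvec b" "?C (bvec b) = ?E (bvec b)" "?D (bvec b) = ?E (bvec b)" for b by blast+
  show "?A u = u"
    by (rule linear_ext[where u = u]) (auto intro!: linear_axioms simp: lin_simps * counit_lin(1,2) vec.scale_left_distrib simp del: lin_bvec alg_sel mul_eq)
  show "?B u = u"
    by (rule linear_ext[where u = u]) (auto intro!: linear_axioms simp: lin_simps * counit_lin(1,2) vec.scale_left_distrib simp del: lin_bvec alg_sel mul_eq)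
  show "?C u = ?E u"
    by (rule linear_ext[where u = u]) (auto intro!: linear_axioms simp: lin_simps * counit_lin(1,2) vec.scale_left_distrib simp del: lin_bvec alg_sel mul_eq)
  show "?D u = ?E u"
    by (rule linear_ext[where u = u]) (auto intro!: linear_axioms simp: lin_simps * counit_lin(1,2) vec.scale_left_distrib simp del: lin_bvec alg_sel mul_eq)
qed

lemma counit_mul: "counit (A4_dual \<omega>) (mul (A4_alg \<omega>) u v) = counit (A4_dual \<omega>) u * counit (A4_dual \<omega>) v"
proof -
  have "\<forall>a b. counit (A4_dual \<omega>) (mul (A4_alg \<omega>) (bvec a) (bvec b)) = counit (A4_dual \<omega>) (bvec a) * counit (A4_dual \<omega>) (bvec b)"
    by (simp add: all_mon counit_lin calc)
  then have 1: "counit (A4_dual \<omega>) (mul (A4_alg \<omega>) (bvec a) (bvec b)) *s w = (counit (A4_dual \<omega>) (bvec a) * counit (A4_dual \<omega>) (bvec b)) *s w"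
    for a b and w :: "'k ^ 1" by simp
  have 2: "counit (A4_dual \<omega>) (mul (A4_alg \<omega>) (bvec a) v) *s w = (counit (A4_dual \<omega>) (bvec a) * counit (A4_dual \<omega>) v) *s w"
    for a and w :: "'k ^ 1"
    by (rule linear_ext[where u = v]) (auto intro!: linear_axioms simp: mul_simps 1 counit_lin(1,2) algebra_simps vec.scale_left_distrib simp del: alg_sel)
  have 3: "counit (A4_dual \<omega>) (mul (A4_alg \<omega>) u v) *s w = (counit (A4_dual \<omega>) u * counit (A4_dual \<omega>) v) *s w"
    for w :: "'k ^ 1"
    by (rule linear_ext[where u = u]) (auto intro!: linear_axioms simp: mul_simps 2 counit_lin(1,2) algebra_simps vec.scale_left_distrib simp del: alg_sel)
  show ?thesis using 3[of "bvec 1"] by (simp add: vec_eq_iff axis_def)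
qed

lemma A4_R_expand: "A4_R \<omega> = (1/2) *s (bvec (G 0) \<otimes> bvec (G 0) + bvec (G 2) \<otimes> bvec (G 0) + bvec (G 0) \<otimes> bvec (G 2) - bvec (G 2) \<otimes> bvec (G 2))
   - bvec (XG 0) \<otimes> bvec (XG 0) + bvec (XG 0) \<otimes> bvec (XG 2) - bvec (XG 2) \<otimes> bvec (XG 0) - bvec (XG 2) \<otimes> bvec (XG 2)"
  by (simp add: A4_R_def Let_def A4_g_def A4_x_def calc eval_nat_numeral npow_0 npow_Suc)

lemmas scale = vec.scale_right_distrib vec.scale_right_diff_distrib two_vec four_vec

context
  assumes two: "(2::'k) \<noteq> 0"
begin

lemma half4: "(4::'k) / 2 = 2"
proof -
  have "(4::'k) = 2 * 2" by simp
  then show ?thesis by (metis nonzero_mult_div_cancel_left two)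
qed

lemma R1:
  "id_comul (A4_dual \<omega>) (A4_R \<omega>) = mul (alg3 (A4_alg \<omega>)) (leg13 (A4_dual \<omega>) (A4_R \<omega>)) (leg12 (A4_dual \<omega>) (A4_R \<omega>))"
  unfolding A4_R_expand leg12_def
  by (simp add: calc comulid_simps leg13_simps reassoc_simps comul_table del: A4_bcomul.simps)
    (simp add: scale two half4)

lemma R2:
  "comul_id (A4_dual \<omega>) (A4_R \<omega>) = mul (alg3 (A4_alg \<omega>)) (leg13 (A4_dual \<omega>) (A4_R \<omega>)) (leg23 (A4_dual \<omega>) (A4_R \<omega>))"
  unfolding A4_R_expand leg23_def
  by (simp add: calc comulid_simps leg13_simps reassoc_simps comul_table del: A4_bcomul.simps)
    (simp add: scale two half4)

lemma R_inverse: "is_inverse (alg2 (A4_alg \<omega>)) (A4_R \<omega>) A4_R_inv"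
  unfolding A4_R_expand A4_R_inv_def is_inverse_def
  by (simp add: calc) (simp add: scale two half4)

lemma R_inv_of: "inv_of (alg2 (A4_alg \<omega>)) (A4_R \<omega>) = A4_R_inv"
  unfolding inv_of_def
proof (rule the_equality)
  show "is_inverse (alg2 (A4_alg \<omega>)) (A4_R \<omega>) A4_R_inv" by (rule R_inverse)
next
  fix v assume v: "is_inverse (alg2 (A4_alg \<omega>)) (A4_R \<omega>) v"
  have A: "is_algebra (alg2 (A4_alg \<omega>))" by (intro tensor_alg_algebra A4_algebra w)
  show "v = A4_R_inv" using A v R_inverse unfolding is_algebra_def is_inverse_def by metis
qed

lemma R_flip: "flip (comul (A4_dual \<omega>) h) = mul (alg2 (A4_alg \<omega>)) (mul (alg2 (A4_alg \<omega>)) (A4_R \<omega>) (comul (A4_dual \<omega>) h)) A4_R_inv"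
proof (rule linear_ext[where u = h])
  have "\<forall>b. flip (comul (A4_dual \<omega>) (bvec b)) = mul (alg2 (A4_alg \<omega>)) (mul (alg2 (A4_alg \<omega>)) (A4_R \<omega>) (comul (A4_dual \<omega>) (bvec b))) A4_R_inv"
    unfolding A4_R_expand A4_R_inv_def
    by (simp add: all_mon all4 calc flip_simps comul_table del: A4_bcomul.simps)
      (simp add: scale two half4)
  then show "flip (comul (A4_dual \<omega>) (bvec b)) = mul (alg2 (A4_alg \<omega>)) (mul (alg2 (A4_alg \<omega>)) (A4_R \<omega>) (comul (A4_dual \<omega>) (bvec b))) A4_R_inv" for b by blast
qed (auto intro!: linear_axioms simp: flip_simps lin_simps mul_simps)

end

end

theorem A4_dual_hopf_algebra:
  assumes "primitive_root_of_unity 4 \<omega>"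
  shows "is_hopf_algebra (A4_dual \<omega>)"
proof -
  note w = primitive4[OF assms]
  have "is_algebra (A4_dual \<omega>)"
    using A4_algebra[OF w] by (simp add: is_algebra_def)
  then show ?thesis
    unfolding is_hopf_algebra_def is_bialgebra_def
    using coassoc[OF w] counits[OF w] comul_mul[OF w] comul_unit[OF w] counit_mul[OF w]
    by (simp add: counit_lin)
qed

theorem A4_R_quasitriangular:
  fixes \<omega> :: "'k::field"
  assumes "CHAR('k) \<noteq> 2" and "primitive_root_of_unity 4 \<omega>"
  shows "quasitriangular (A4_dual \<omega>) (A4_R \<omega>)"
proof -
  note w = primitive4[OF assms(2)] and two = two_nonzero[OF assms(1)]
  show ?thesis
    unfolding quasitriangular_def
    using R_inverse[OF w two] R_inv_of[OF w two] R_flip[OF w two] R1[OF w two] R2[OF w two] by auto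
qed

end

theory Submission
  imports Defs
begin

text \<open>
  In coordinates, the equation for \<open>(Id \<otimes> \<Delta>)(\<chi>)\<close> only involves the elements
  \<open>R\<^sup>-\<^sup>1 (h \<otimes> 1) R\<close>, and the one for \<open>(\<Delta> \<otimes> Id)(\<chi>)\<close> the elements \<open>R\<^sup>-\<^sup>1 (1 \<otimes> h) R\<close>; both are
  given by short formulas on the basis. The first equation kills the coefficients of \<open>\<chi>\<close> at
  \<open>g\<^sup>i \<otimes> h\<close>, the second those at \<open>x g\<^sup>i \<otimes> h\<close> with \<open>i \<noteq> 0\<close> and those at \<open>x \<otimes> g\<^sup>j\<close>, and the first
  again those at \<open>x \<otimes> x g\<^sup>j\<close> with \<open>j \<noteq> 2\<close>. The remaining multiple of \<open>x \<otimes> x g\<^sup>2\<close> satisfies both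
  equations, but it anticommutes with \<open>g \<otimes> g\<close> and so does not commute with \<open>\<Delta>(g)\<close>.
\<close>

lemma sum_prod_UNIV: "(\<Sum>p\<in>UNIV. f p) = (\<Sum>a\<in>UNIV. \<Sum>b\<in>UNIV. f (a, b))"
  by (simp add: sum.cartesian_product flip: UNIV_Times_UNIV)

lemma lin_nth: "lin f u $ i = (\<Sum>b\<in>UNIV. u $ b * f b $ i)"
  by (simp add: lin_def)

lemma id_comul_nth: "id_comul H t $ (a, b, c) = (\<Sum>q\<in>UNIV. t $ (a, q) * bcomul H q $ (b, c))"
  unfolding id_comul_def lin_nth sum_prod_UNIV
  by (subst sum.swap) (simp add: tensor_nth axis_def if_distrib[of "\<lambda>c. c * _"]
      if_distrib[of "\<lambda>c. _ * c"] cong: if_cong)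

lemma comul_id_nth: "comul_id H t $ (a, b, c) = (\<Sum>p\<in>UNIV. t $ (p, c) * bcomul H p $ (a, b))"
  unfolding comul_id_def lin_nth sum_prod_UNIV
  by (simp add: reassoc_def tensor_nth axis_def if_distrib[of "\<lambda>c. c * _"]
      if_distrib[of "\<lambda>c. _ * c"] cong: if_cong)

lemma leg12_nth: "leg12 H t $ (a, b, c) = t $ (a, b) * unit H $ c"
  by (simp add: leg12_def reassoc_def tensor_nth)

lemma leg23_nth: "leg23 H t $ (a, b, c) = unit H $ a * t $ (b, c)"
  by (simp add: leg23_def tensor_nth)

text \<open>\<open>leg12\<close> is built with left bracketing but \<open>alg3\<close> is bracketed
  to the right; rebracketing is multiplicative on basis tensors, hence everywhere by
  linearity.\<close>

lemma mul_reassoc: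
  "mul (tensor_alg A (tensor_alg B C)) (reassoc s) (reassoc t) =
    reassoc (mul (tensor_alg (tensor_alg A B) C) s t)"
proof -
  have 1: "mul (tensor_alg A (tensor_alg B C)) (reassoc (bvec p)) (reassoc (bvec q)) =
      reassoc (mul (tensor_alg (tensor_alg A B) C) (bvec p) (bvec q))" for p q
    by (cases p; cases "fst p"; cases q; cases "fst q")
      (simp add: bvec_tensor reassoc_simps mul_tensor)
  have 2: "mul (tensor_alg A (tensor_alg B C)) (reassoc (bvec p)) (reassoc t) =
      reassoc (mul (tensor_alg (tensor_alg A B) C) (bvec p) t)" for p
    by (rule linear_ext[where u = t])
      (auto intro!: linear_axioms simp: mul_simps reassoc_simps 1)
  show ?thesis
    by (rule linear_ext[where u = s])
      (auto intro!: linear_axioms simp: mul_simps reassoc_simps 2)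
qed

text \<open>Both \<open>leg12\<close> factors have the unit in the third leg, so the second index of
  \<open>t\<close> is only carried along.\<close>

lemma leg12_conj:
  fixes H :: "('b::finite, 'k::field, 'z) alg_scheme"
  assumes "is_algebra H"
  shows "mul (alg3 H) (mul (alg3 H) (leg12 H s) (leg13 H t)) (leg12 H u) $ (a, b, c) =
    (\<Sum>p\<in>UNIV. t $ (p, c) * mul (alg2 H) (mul (alg2 H) s (bvec p \<otimes> unit H)) u $ (a, b))"
proof -
  have "mul (alg3 H) (mul (alg3 H) (leg12 H s) (leg13 H t)) (leg12 H u) =
    lin (\<lambda>p. reassoc (mul (alg2 H) (mul (alg2 H) s (bvec (fst p) \<otimes> unit H)) u \<otimes> bvec (snd p))) t"
  proof (rule linear_ext[where u = t])
    fix p :: "'b \<times> 'b"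
    have "leg13 H (bvec p) = reassoc ((bvec (fst p) \<otimes> unit H) \<otimes> bvec (snd p))"
      by (cases p) (simp add: bvec_tensor leg13_simps reassoc_simps)
    then show "mul (alg3 H) (mul (alg3 H) (leg12 H s) (leg13 H (bvec p))) (leg12 H u) =
      lin (\<lambda>p. reassoc (mul (alg2 H) (mul (alg2 H) s (bvec (fst p) \<otimes> unit H)) u \<otimes> bvec (snd p)))
        (bvec p)"
      using assms by (simp add: leg12_def mul_reassoc mul_tensor is_algebra_def)
  qed (auto intro!: linear_axioms simp: leg13_simps mul_simps lin_simps)
  then show ?thesis
    by (simp add: lin_nth sum_prod_UNIV reassoc_def tensor_nth axis_def
        if_distrib[of "\<lambda>c. _ * c"] cong: if_cong)
qed

lemma leg23_conj:
  fixes H :: "('b::finite, 'k::field, 'z) alg_scheme"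
  assumes "is_algebra H"
  shows "mul (alg3 H) (mul (alg3 H) (leg23 H s) (leg13 H t)) (leg23 H u) $ (a, b, c) =
    (\<Sum>q\<in>UNIV. t $ (a, q) * mul (alg2 H) (mul (alg2 H) s (unit H \<otimes> bvec q)) u $ (b, c))"
proof -
  have "mul (alg3 H) (mul (alg3 H) (leg23 H s) (leg13 H t)) (leg23 H u) =
    lin (\<lambda>p. bvec (fst p) \<otimes> mul (alg2 H) (mul (alg2 H) s (unit H \<otimes> bvec (snd p))) u) t"
  proof (rule linear_ext[where u = t])
    fix p :: "'b \<times> 'b"
    have "leg13 H (bvec p) = bvec (fst p) \<otimes> unit H \<otimes> bvec (snd p)"
      by (cases p) (simp add: bvec_tensor leg13_simps)
    then show "mul (alg3 H) (mul (alg3 H) (leg23 H s) (leg13 H (bvec p))) (leg23 H u) =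
      lin (\<lambda>p. bvec (fst p) \<otimes> mul (alg2 H) (mul (alg2 H) s (unit H \<otimes> bvec (snd p))) u) (bvec p)"
      using assms by (simp add: leg23_def mul_tensor is_algebra_def)
  qed (auto intro!: linear_axioms simp: leg13_simps mul_simps lin_simps)
  then have "mul (alg3 H) (mul (alg3 H) (leg23 H s) (leg13 H t)) (leg23 H u) $ (a, b, c) =
    (\<Sum>p\<in>UNIV. \<Sum>q\<in>UNIV. t $ (p, q) * (bvec p \<otimes>
      mul (alg2 H) (mul (alg2 H) s (unit H \<otimes> bvec q)) u) $ (a, b, c))"
    by (simp add: lin_nth sum_prod_UNIV)
  then show ?thesis
    by (subst (asm) sum.swap) (simp add: tensor_nth axis_def
        if_distrib[of "\<lambda>c. c * _"] if_distrib[of "\<lambda>c. _ * c"] cong: if_cong)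
qed

text \<open>For g^i the x-terms of R give the correction, through x g^i - g^i x = (1 -
  \<omega>^(-i)) x g^i. For x g^i they vanish by x^2 = 0, and the other terms leave g^2 in the
  second leg because g^2 anticommutes with x.\<close>

lemma R_conj_left:
  fixes \<omega> :: "'k::field"
  assumes "\<omega> * \<omega> = - 1" "(2::'k) \<noteq> 0"
  shows "\<forall>p. mul (alg2 (A4_alg \<omega>)) (mul (alg2 (A4_alg \<omega>)) A4_R_inv (bvec p \<otimes> bvec (G 0)))
      (A4_R \<omega>) =
    (case p of
      G i \<Rightarrow> bvec (G i) \<otimes> bvec (G 0) - (2 * (1 - \<omega> powi (- Rep_bit0 i))) *s
        (bvec (XG i) \<otimes> bvec (XG 2))
    | XG i \<Rightarrow> bvec (XG i) \<otimes> bvec (G 2))"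
proof -
  \<comment> \<open>The factors 1/2 of R and its inverse multiply to 1/4.\<close>
  have "(4::'k) \<noteq> 0"
    using assms(2) mult_eq_0_iff[of 2 "2::'k"] by simp
  then show ?thesis
    unfolding A4_R_expand[OF assms(1)] A4_R_inv_def
    by (simp add: all_mon all4 calc[OF assms(1)]) (simp add: vec_eq_iff field_simps assms(2))
qed

lemma R_conj_right:
  fixes \<omega> :: "'k::field"
  assumes "\<omega> * \<omega> = - 1" "(2::'k) \<noteq> 0"
  shows "\<forall>p. mul (alg2 (A4_alg \<omega>)) (mul (alg2 (A4_alg \<omega>)) A4_R_inv (bvec (G 0) \<otimes> bvec p))
      (A4_R \<omega>) =
    (case p of
      G i \<Rightarrow> bvec (G 0) \<otimes> bvec (G i) - (2 * (1 - \<omega> powi (- Rep_bit0 i))) *s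
        (bvec (XG 0) \<otimes> bvec (XG (i + 2)))
    | XG i \<Rightarrow> bvec (G 2) \<otimes> bvec (XG i))"
proof -
  have "(4::'k) \<noteq> 0"
    using assms(2) mult_eq_0_iff[of 2 "2::'k"] by simp
  then show ?thesis
    unfolding A4_R_expand[OF assms(1)] A4_R_inv_def
    by (simp add: all_mon all4 calc[OF assms(1)]) (simp add: vec_eq_iff field_simps assms(2))
qed

lemma mod4_induct: "P 0 \<Longrightarrow> P 1 \<Longrightarrow> P 2 \<Longrightarrow> P 3 \<Longrightarrow> P (i :: 4)"
  using all4[of P] by blast

lemma mon_induct:
  assumes "P (G 0)" "P (G 1)" "P (G 2)" "P (G 3)" "P (XG 0)" "P (XG 1)" "P (XG 2)" "P (XG 3)"
  shows "P m"
  using assms all_mon[of P] by (simp add: all4)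

lemma sum_mon:
  "sum f (UNIV :: mon set) =
    f (G 0) + f (G 1) + f (G 2) + f (G 3) + f (XG 0) + f (XG 1) + f (XG 2) + f (XG 3)"
proof -
  have "(UNIV :: 4 set) = {0, 1, 2, 3}"
    using all4[of "\<lambda>i. i \<in> {0, 1, 2, 3}"] by auto
  then have mon: "(UNIV :: mon set) = {G 0, G 1, G 2, G 3, XG 0, XG 1, XG 2, XG 3}"
    unfolding UNIV_mon by auto
  show ?thesis
    unfolding mon by (simp add: add.assoc)
qed

declare A4_bcomul.simps [simp del]

theorem proposition4p2:
  fixes \<omega> :: "'k::field" and chi :: "'k ^ (mon \<times> mon)"
  assumes "CHAR('k) \<noteq> 2"
    and "primitive_root_of_unity 4 \<omega>"
    and "infinitesimal_R_matrix (A4_dual \<omega>) (A4_R \<omega>) chi"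
  shows "chi = 0"
proof -
  note w = primitive4[OF assms(2)] and two = two_nonzero[OF assms(1)]
  have alg: "is_algebra (A4_dual \<omega>)"
    using A4_dual_hopf_algebra[OF assms(2)] by (simp add: is_hopf_algebra_def is_bialgebra_def)
  have inv: "inv_of (alg2 (A4_dual \<omega>)) (A4_R \<omega>) = A4_R_inv"
    using R_inv_of[OF w two] by simp
  note comps = comul_table[OF w] sum_mon powi4[OF w] Rep4 tensor_nth axis_def
  have "id_comul (A4_dual \<omega>) chi $ (a, b, c) = leg12 (A4_dual \<omega>) chi $ (a, b, c) +
      mul (alg3 (A4_dual \<omega>)) (mul (alg3 (A4_dual \<omega>)) (leg12 (A4_dual \<omega>) A4_R_inv)
        (leg13 (A4_dual \<omega>) chi)) (leg12 (A4_dual \<omega>) (A4_R \<omega>)) $ (a, b, c)" for a b c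
    using assms(3) unfolding infinitesimal_R_matrix_def inv by simp
  note A = this[unfolded leg12_conj[OF alg] id_comul_nth leg12_nth,
      simplified R_conj_left[OF w two, rule_format] alg_sel tensor_alg_eq]
  have "comul_id (A4_dual \<omega>) chi $ (a, b, c) = leg23 (A4_dual \<omega>) chi $ (a, b, c) +
      mul (alg3 (A4_dual \<omega>)) (mul (alg3 (A4_dual \<omega>)) (leg23 (A4_dual \<omega>) A4_R_inv)
        (leg13 (A4_dual \<omega>) chi)) (leg23 (A4_dual \<omega>) (A4_R \<omega>)) $ (a, b, c)" for a b c
    using assms(3) unfolding infinitesimal_R_matrix_def inv by simp
  note B = this[unfolded leg23_conj[OF alg] comul_id_nth leg23_nth,
      simplified R_conj_right[OF w two, rule_format] alg_sel tensor_alg_eq]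
  have "(2::'k) \<noteq> 1"
    by (metis add_cancel_right_right one_add_one one_neq_zero)
  \<comment> \<open>For j = 0 the equation reads y = 2y.\<close>
  then have GG: "chi $ (G i, G j) = 0" for i j
    using A[of "G i" "G 0" "G j"]
    by - (induct i rule: mod4_induct; induct j rule: mod4_induct;
      simp add: comps)
  \<comment> \<open>At j = 0 this component is a tautology, since \<Delta>(x) contains 1 \<otimes>
    x.\<close>
  have GX: "chi $ (G i, XG j) = 0" if "j \<noteq> 0" for i j
    using A[of "G i" "G 0" "XG j"] that
    by - (induct i rule: mod4_induct; induct j rule: mod4_induct;
      simp add: comps)
  \<comment> \<open>x \<otimes> 1 occurs in no \<Delta>(q), and g^i \<otimes> x in no conjugate, so
    only the \<open>leg12\<close> term survives.\<close>
  have GX0: "chi $ (G i, XG 0) = 0" for i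
    using A[of "G i" "XG 0" "G 0"]
    by (induct i rule: mod4_induct) (simp_all add: comps GG)
  \<comment> \<open>The conjugated terms involve only the row of \<open>G 0\<close>, already zero; i
    = 0 is excluded because of 1 \<otimes> x in \<Delta>(x).\<close>
  have XG: "chi $ (XG i, c) = 0" if "i \<noteq> 0" for i c
    using B[where a = "G 0" and b = "XG i" and c = c] that
    by - (induct i rule: mod4_induct; induct c rule: mon_induct;
      simp add: comps GG GX GX0)
  have X0G: "chi $ (XG 0, G j) = 0" for j
    using B[where a = "XG 0" and b = "G 0" and c = "G j"]
    by (induct j rule: mod4_induct) (simp_all add: comps)
  \<comment> \<open>The left side picks g^j \<otimes> x g^j from \<Delta>(x g^j). The conjugate of x
    \<otimes> 1 is x \<otimes> g^2, so both sides agree at j = 2 and nothing follows there.\<close>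
  have X0X: "chi $ (XG 0, XG j) = 0" if "j \<noteq> 2" for j
    using A[of "XG 0" "G j" "XG j"] that
    by (induct j rule: mod4_induct) (simp_all add: comps XG GX GX0)
  define s where "s = chi $ (XG 0, XG 2)"
  have chi: "chi = s *s (bvec (XG 0) \<otimes> bvec (XG 2))"
  proof -
    have "\<forall>a b. chi $ (a, b) = (s *s (bvec (XG 0) \<otimes> bvec (XG 2))) $ (a, b)"
      using GG GX GX0 XG X0G X0X by (auto simp: all_mon all4 s_def tensor_nth axis_def)
    then show ?thesis
      by (simp add: vec_eq_iff)
  qed
  have "mul (alg2 (A4_alg \<omega>)) chi (comul (A4_dual \<omega>) (bvec (G 1))) =
      mul (alg2 (A4_alg \<omega>)) (comul (A4_dual \<omega>) (bvec (G 1))) chi"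
    using assms(3) unfolding infinitesimal_R_matrix_def by (metis tensor_alg_eq)
  \<comment> \<open>The x-term of \<Delta>(g) annihilates \<open>chi\<close> by x^2 = 0; the sign is
    \<omega>^(-2), from moving g past x in the second leg and in the first.\<close>
  then have "s *s (bvec (XG 1) \<otimes> bvec (XG 3)) = - (s *s (bvec (XG 1) \<otimes> bvec (XG 3)))"
    unfolding chi by (simp add: calc[OF w] comul_table[OF w])
  from arg_cong[OF this, of "\<lambda>t. t $ (XG 1, XG 3)"] have "s = - s"
    by (simp add: tensor_nth)
  then have "2 * s = 0"
    by (metis add.right_inverse mult_2)
  then show ?thesis
    using two chi by simp
qed

end
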